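(* Let $\boldsymbol{f}^n \in \mathbb{R}_+^N$ with $\|\boldsymbol{f}^n\|_1 = V$, let $\boldsymbol{f}(t_{n+1})$ be the exact solution at time $t_{n+1}$ of the ODE system started from $\boldsymbol{f}^n$ at time $t_n$ (see context), and let $\boldsymbol{f}^{n+1}$ be a numerical approximation produced by a positive and conservative scheme, i.e. $\boldsymbol{f}^{n+1} \in \mathbb{R}_+^N$ and $\|\boldsymbol{f}^{n+1}\|_1 = \|\boldsymbol{f}(t_{n+1})\|_1 = V$. Let the indices be ordered so that $f_1^{n+1} \le f_2^{n+1} \le \cdots \le f_N^{n+1}$. For any $C_1, C_f \in (0,1]$ there exist two positive constants $\delta$ and $M$, where $\delta$ depends only on $C_1$, $C_f$ and $V$, and $M$ depends only on $C_1$, $C_f$, $V$, $\|\boldsymbol{f}^{n+1}\|_\infty$ and $\|\boldsymbol{f}(t_{n+1})\|_\infty$, such that $$\|\beta(\boldsymbol{1} - \boldsymbol{f}^{n+1})\|_2 \le M\, \|\boldsymbol{f}^{n+1} - \boldsymbol{f}(t_{n+1})\|_2$$ if all the following conditions hold: (i) $\eta(\boldsymbol{f}^{n+1}) > \eta(\boldsymbol{f}^n)$, and $\beta \in (0,1]$ satisfies $\eta\big(\boldsymbol{f}^{n+1} + \beta(\boldsymbol{1} - \boldsymbol{f}^{n+1})\big) = \eta(\boldsymbol{f}(t_{n+1}))$; (ii) $\|\boldsymbol{f}^{n+1} - \boldsymbol{f}(t_{n+1})\|_2 < \delta$; (iii) the index $I_1 = \min\{I \mid \sum_{i=1}^I \Delta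 v_i \ge C_1 V\}$ satisfies $$\frac{1}{|\log(f_1^{n+1})|} \ge \frac{C_f}{|\log(f_{I_1}^{n+1})|}.$$
   Context: $N \ge 1$ is an integer, $\Delta v_1,\dots,\Delta v_N > 0$ are fixed weights (ordered together with the components when indices are relabelled), $V = \sum_{i=1}^N \Delta v_i$, $\boldsymbol{1} = (1,\dots,1)^T$, and $\mathbb{R}_+ = [0,\infty)$. Norms are weighted: $\|\boldsymbol{f}\|_p = \big(\sum_{i=1}^N |f_i|^p \Delta v_i\big)^{1/p}$ for $p=1,2$, and $\|\boldsymbol{f}\|_\infty = \max_i |f_i|$. The Gibbs entropy is $\eta(\boldsymbol{f}) = \sum_{i=1}^N f_i \log f_i\, \Delta v_i$, with $0\log 0 = 0$. In condition (iii), the function $1/|\log x|$ takes values in $[0,+\infty]$; it is regarded as $0$ at $x=0$ and as $+\infty$ at $x=1$. The ODE system is $\frac{\mathrm{d} f_i}{\mathrm{d}t} = Q_i(\boldsymbol{f}(t))$, $i=1,\dots,N$. It is assumed that its solutions (with nonnegative initial data) have the properties: conservation of mass, $\frac{\mathrm{d}}{\mathrm{d}t}\sum_i f_i(t)\Delta v_i = 0$; nonnegativity, $f_i(t) \ge 0$; monotonicity of entropy, $\frac{\mathrm{d}}{\mathrm{d}t}\sum_i f_i(t)\log f_i(t)\Delta v_i \le 0$, i.e. $\eta(\boldsymbol{f}(t))$ is nonincreasing in $t$. Here $t_n < t_{n+1}$ and $\boldsymbol{f}(t)$ denotes the solution with $\boldsymbol{f}(t_n) = \boldsymbol{f}^n$;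 in particular $\eta(\boldsymbol{f}(t_{n+1})) \le \eta(\boldsymbol{f}^n)$. All vectors are normalized so that the weighted average of their components is $1$, i.e. $\|\cdot\|_1 = V$. *)

theory Defs
  imports "HOL-Analysis.Analysis"
begin

text \<open>
  The constants in the theorem are uniform in the dimension, so \<open>N\<close> is quantified inside an
  existential and cannot be a type. A vector in \<open>\<real>\<^sup>N\<close> is an extensional function on \<open>{1..N}\<close>,
  which makes it determined by its \<open>N\<close> components (this matters for the argument of \<open>Q\<close>).
  Throughout, \<open>v i\<close> is the weight \<open>\<Delta>v\<^sub>i\<close>.
\<close>

definition vecs :: "nat \<Rightarrow> (nat \<Rightarrow> real) set" where
  "vecs N = {1..N} \<rightarrow>\<^sub>E UNIV"

definition nonneg_vecs :: "nat \<Rightarrow> (nat \<Rightarrow> real) set" where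
  "nonneg_vecs N = {1..N} \<rightarrow>\<^sub>E {0..}"

definition wnorm :: "nat \<Rightarrow> (nat \<Rightarrow> real) \<Rightarrow> real \<Rightarrow> (nat \<Rightarrow> real) \<Rightarrow> real" where
  "wnorm N v p f = (\<Sum>i=1..N. \<bar>f i\<bar> powr p * v i) powr (1 / p)"

definition maxnorm :: "nat \<Rightarrow> (nat \<Rightarrow> real) \<Rightarrow> real" where
  "maxnorm N f = Max ((\<lambda>i. \<bar>f i\<bar>) ` {1..N})"

definition entropy :: "nat \<Rightarrow> (nat \<Rightarrow> real) \<Rightarrow> (nat \<Rightarrow> real) \<Rightarrow> real" where
  "entropy N v f = (\<Sum>i=1..N. f i * ln (f i) * v i)"

definition ode_solution ::
  "nat \<Rightarrow> ((nat \<Rightarrow> real) \<Rightarrow> nat \<Rightarrow> real) \<Rightarrow> real \<Rightarrow> real \<Rightarrow> (real \<Rightarrow> nat \<Rightarrow> real) \<Rightarrow> bool" where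
  "ode_solution N Q a b f \<longleftrightarrow>
     (\<forall>t\<in>{a..b}. f t \<in> vecs N \<and>
        (\<forall>i\<in>{1..N}. ((\<lambda>s. f s i) has_real_derivative Q (f t) i) (at t within {a..b})))"

text \<open>
  The standing assumption on the system: conservation of mass, nonnegativity and monotonicity of
  entropy, for all solutions with nonnegative initial data.
\<close>

definition entropic_system ::
  "nat \<Rightarrow> (nat \<Rightarrow> real) \<Rightarrow> ((nat \<Rightarrow> real) \<Rightarrow> nat \<Rightarrow> real) \<Rightarrow> bool" where
  "entropic_system N v Q \<longleftrightarrow>
     (\<forall>a b f. a < b \<longrightarrow> ode_solution N Q a b f \<longrightarrow> f a \<in> nonneg_vecs N \<longrightarrow>
        (\<forall>t\<in>{a..b}. ((\<lambda>s. \<Sum>i=1..N. f s i * v i) has_real_derivative 0) (at t within {a..b})) \<and>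
        (\<forall>t\<in>{a..b}. \<forall>i\<in>{1..N}. 0 \<le> f t i) \<and>
        antimono_on {a..b} (\<lambda>t. entropy N v (f t)))"

text \<open>
  The function \<open>1 / \<bar>log x\<bar>\<close> with values in \<open>[0,\<infinity>]\<close>. The case \<open>x = 0\<close> is separate since
  \<open>ln 0 = 0\<close> in the library.
\<close>

definition inv_abs_log :: "real \<Rightarrow> ennreal" where
  "inv_abs_log x = (if x = 0 then 0 else if x = 1 then \<infinity> else ennreal (1 / \<bar>ln x\<bar>))"

definition mass_index :: "nat \<Rightarrow> (nat \<Rightarrow> real) \<Rightarrow> real \<Rightarrow> nat" where
  "mass_index N v m = (LEAST I. I \<in> {1..N} \<and> (\<Sum>i=1..I. v i) \<ge> m)"

end

theory Submission
  imports Defs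
begin

text \<open>
  Write \<open>g\<close> for the numerical and \<open>h\<close> for the exact solution, \<open>err\<close> for the weighted 2-norm of
  \<open>g - h\<close> and \<open>R \<ge> 1\<close> for a bound on \<open>g\<close>. Relaxing \<open>g\<close> towards \<open>1\<close> lowers the entropy in each
  component, so by convexity the gap \<open>\<eta>(g) - \<eta>(h)\<close> is at least
  \<open>s * (\<Sum>i. (g i - 1) * ln (g i + s * (1 - g i)) * v i)\<close> for every \<open>s \<in> (0, \<beta>]\<close>; it is at
  most \<open>\<Sum>i. \<bar>g i - h i\<bar> * \<bar>ln (max (g i) \<sigma>)\<bar> * v i\<close> plus \<open>\<sigma>\<close> times the total weight, for
  every \<open>\<sigma> > 0\<close>. Let \<open>m\<close> be a small threshold depending on \<open>R\<close>. If \<open>g 1 \<ge> m\<close>, then \<open>ln (g i)\<close> is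
  comparable to \<open>g i - 1\<close> and the Cauchy-Schwarz inequality suffices. If \<open>g 1 < m\<close> and
  \<open>err < m\<close>, condition (iii) provides a fixed fraction of the weight on which \<open>g\<close> is at most a power
  of \<open>max (g 1) err\<close>; with \<open>\<sigma> = err\<close> and \<open>s\<close> proportional to \<open>err\<close> both bounds then grow like
  \<open>err * \<bar>ln (max (g 1) err)\<bar>\<close>, which forces \<open>\<beta>\<close> to be of order \<open>err\<close>. If \<open>err \<ge> m\<close> the claim is
  trivial; as \<open>M\<close> may depend on \<open>R\<close>, this makes any \<open>\<delta>\<close> admissible.
\<close>

section \<open>Pointwise inequalities for the entropy density\<close>

lemma ln_ge_one_minus_inverse:
  fixes x :: real
  assumes "0 < x"
  shows "(x - 1) / x \<le> ln x"
  using ln_le_minus_one[of "1 / x"] assms by (simp add: ln_div diff_divide_distrib)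

text \<open>The left side is the value at \<open>x\<close> of the tangent at \<open>y\<close> to the
  convex function \<open>x * ln x - x\<close>, whose derivative is \<open>ln\<close>.\<close>

lemma xlnx_tangent:
  fixes x y :: real
  assumes "0 \<le> x" "0 < y"
  shows "x * ln y - y \<le> x * ln x - x"
proof (cases "x = 0")
  case False
  then have x: "0 < x" using assms by simp
  then have "ln (y / x) \<le> y / x - 1" using assms by (intro ln_le_minus_one) simp
  then have "x * ln (y / x) \<le> x * (y / x - 1)" using x by (intro mult_left_mono) simp_all
  then show ?thesis using x assms by (simp add: ln_div algebra_simps)
qed (use assms in simp)

text \<open>Convexity, with the tangent taken at \<open>max x \<sigma>\<close> so that its slope
  stays bounded as \<open>x\<close> tends to 0; the shift costs at most
  \<open>\<sigma>\<close>.\<close>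

lemma xlnx_diff_le:
  fixes x y \<sigma> :: real
  assumes "0 \<le> x" "0 \<le> y" "0 < \<sigma>"
  shows "(x * ln x - x) - (y * ln y - y) \<le> (x - y) * ln (max x \<sigma>) + \<sigma>"
proof -
  have tangent: "y * ln (max x \<sigma>) - max x \<sigma> \<le> y * ln y - y"
    using assms by (intro xlnx_tangent) auto
  show ?thesis
  proof (cases "x = 0")
    case False
    then have "x * ln x \<le> x * ln (max x \<sigma>)"
      using assms by (intro mult_left_mono) auto
    then show ?thesis using tangent assms by (auto simp: algebra_simps)
  qed (use tangent assms in \<open>auto simp: algebra_simps\<close>)
qed

text \<open>The relaxed value \<open>y\<close> satisfies \<open>y - 1 = (1 - s) * (x - 1)\<close>.
  Above 1, \<open>ln y \<ge> (y - 1) / y\<close> and \<open>y \<le> R\<close> give the bound; below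
  1, \<open>ln y \<le> y - 1\<close> does.\<close>

lemma relaxation_ln_ge:
  fixes x s R :: real
  assumes "0 \<le> x" "x \<le> R" "1 \<le> R" "0 < s" "s \<le> 1"
  shows "(1 - s) * (x - 1)\<^sup>2 / R \<le> (x - 1) * ln (x + s * (1 - x))"
proof -
  define y where "y = x + s * (1 - x)"
  have y1: "y - 1 = (1 - s) * (x - 1)" by (simp add: y_def algebra_simps)
  have y0: "0 < y"
  proof (cases "x = 0")
    case False
    have "y = (1 - s) * x + s" by (simp add: y_def algebra_simps)
    then show ?thesis using assms by (simp add: add_nonneg_pos)
  qed (use assms y_def in simp)
  show ?thesis
  proof (cases "1 \<le> x")
    case True
    have "y \<le> x" using True assms by (simp add: y_def mult_nonneg_nonpos)
    then have "y \<le> R" using assms by simp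
    have ge: "0 \<le> y - 1" unfolding y1 using True assms by simp
    have "(y - 1) / R \<le> (y - 1) / y" using ge y0 \<open>y \<le> R\<close> by (intro divide_left_mono) auto
    also have "\<dots> \<le> ln y" using y0 by (rule ln_ge_one_minus_inverse)
    finally have "(x - 1) * ((y - 1) / R) \<le> (x - 1) * ln y"
      using True by (intro mult_left_mono) simp_all
    then show ?thesis unfolding y1 y_def[symmetric] by (simp add: power2_eq_square mult_ac)
  next
    case False
    have "(1 - s) * (x - 1)\<^sup>2 / R \<le> (1 - s) * (x - 1)\<^sup>2 / 1"
      using assms by (intro divide_left_mono) auto
    also have "\<dots> = (x - 1) * (y - 1)" unfolding y1 by (simp add: power2_eq_square)
    also have "\<dots> \<le> (x - 1) * ln y"
      using False ln_le_minus_one[OF y0] by (intro mult_left_mono_neg) auto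
    finally show ?thesis by (simp add: y_def)
  qed
qed

text \<open>The way from \<open>x\<close> to \<open>z\<close> is split at the point \<open>y\<close>
  with parameter \<open>s\<close>. The tangent at \<open>y\<close> yields the drop on the first
  piece; the tangent at \<open>z\<close> shows that the second piece causes no increase.\<close>

lemma xlnx_relaxation_drop:
  fixes x s \<beta> :: real
  assumes "0 \<le> x" "0 < s" "s \<le> \<beta>" "\<beta> \<le> 1"
  defines "z \<equiv> x + \<beta> * (1 - x)"
  shows "s * ((x - 1) * ln (x + s * (1 - x))) \<le> (x * ln x - x) - (z * ln z - z)"
proof -
  define y where "y = x + s * (1 - x)"
  have pos: "0 < x + r * (1 - x)" if "0 < r" "r \<le> 1" for r
  proof -
    have "x + r * (1 - x) = (1 - r) * x + r" by (simp add: algebra_simps)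
    then show ?thesis using that assms by (simp add: add_nonneg_pos)
  qed
  have y: "0 < y" and z: "0 < z" using pos assms by (auto simp: y_def z_def)
  have "0 \<le> (1 - \<beta>) * (x - 1)\<^sup>2 / max x 1" using assms by simp
  also have "\<dots> \<le> (x - 1) * ln z" unfolding z_def by (rule relaxation_ln_ge) (use assms in auto)
  finally have "0 \<le> (\<beta> - s) * ((x - 1) * ln z)" using assms by simp
  also have "\<dots> = (y - z) * ln z" by (simp add: y_def z_def algebra_simps)
  finally have "z * ln z - z \<le> y * ln y - y"
    using xlnx_tangent[of y z] y z by (simp add: algebra_simps)
  moreover have "(x - y) * ln y = s * ((x - 1) * ln y)" by (simp add: y_def algebra_simps)
  ultimately show ?thesis
    using xlnx_tangent[of x y] y assms(1) unfolding y_def[symmetric] by (simp add: algebra_simps)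
qed

section \<open>Weighted norms\<close>

lemma wnorm_1: "\<forall>i\<in>{1..N}. 0 \<le> v i \<Longrightarrow> wnorm N v 1 f = (\<Sum>i=1..N. \<bar>f i\<bar> * v i)"
  using sum_nonneg[of "{1..N}" "\<lambda>i. \<bar>f i\<bar> * v i"]
  by (simp add: wnorm_def)

lemma wnorm_2:
  assumes "\<forall>i\<in>{1..N}. 0 \<le> v i"
  shows "wnorm N v 2 f = sqrt (\<Sum>i=1..N. (f i)\<^sup>2 * v i)"
proof -
  have "0 \<le> (\<Sum>i=1..N. (f i)\<^sup>2 * v i)" using assms by (intro sum_nonneg) simp
  then show ?thesis by (simp add: wnorm_def powr_half_sqrt)
qed

lemma wnorm_2_nonneg: "0 \<le> wnorm N v 2 f"
  by (simp add: wnorm_def)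

lemma wnorm_2_cmult:
  assumes "\<forall>i\<in>{1..N}. 0 \<le> v i" "0 \<le> c"
  shows "wnorm N v 2 (\<lambda>i. c * f i) = c * wnorm N v 2 f"
proof -
  have "(\<Sum>i=1..N. (c * f i)\<^sup>2 * v i) = c\<^sup>2 * (\<Sum>i=1..N. (f i)\<^sup>2 * v i)"
    by (simp add: sum_distrib_left power_mult_distrib mult.assoc)
  then show ?thesis unfolding wnorm_2[OF assms(1)] using assms(2) by (simp only: real_sqrt_mult) simp
qed

lemma wnorm_2_le:
  assumes "\<forall>i\<in>{1..N}. 0 \<le> v i" "\<And>i. i \<in> {1..N} \<Longrightarrow> \<bar>f i\<bar> \<le> B" "0 \<le> B"
  shows "wnorm N v 2 f \<le> B * sqrt (\<Sum>i=1..N. v i)"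
proof -
  have "(\<Sum>i=1..N. (f i)\<^sup>2 * v i) \<le> (\<Sum>i=1..N. B\<^sup>2 * v i)"
    using assms by (intro sum_mono mult_right_mono) (auto simp: abs_le_square_iff[symmetric])
  then have "wnorm N v 2 f \<le> sqrt (B\<^sup>2 * (\<Sum>i=1..N. v i))"
    unfolding wnorm_2[OF assms(1)] sum_distrib_left by (rule real_sqrt_le_mono)
  then show ?thesis using assms(3) by (simp add: real_sqrt_mult)
qed

lemma wnorm_2_Cauchy_Schwarz:
  assumes "\<forall>i\<in>{1..N}. 0 \<le> v i"
  shows "(\<Sum>i=1..N. \<bar>f i\<bar> * \<bar>g i\<bar> * v i) \<le> wnorm N v 2 f * wnorm N v 2 g"
proof -
  have L2: "wnorm N v 2 f = L2_set (\<lambda>i. f i * sqrt (v i)) {1..N}" for f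
    unfolding wnorm_2[OF assms] L2_set_def
    using assms by (intro arg_cong[where f = sqrt] sum.cong) (auto simp: power_mult_distrib)
  have "(\<Sum>i=1..N. \<bar>f i\<bar> * \<bar>g i\<bar> * v i)
      = (\<Sum>i=1..N. \<bar>f i * sqrt (v i)\<bar> * \<bar>g i * sqrt (v i)\<bar>)"
    using assms by (intro sum.cong) (auto simp: abs_mult)
  also have "\<dots> \<le> wnorm N v 2 f * wnorm N v 2 g" unfolding L2 by (rule L2_set_mult_ineq)
  finally show ?thesis .
qed

section \<open>Two-sided bounds for the entropy gap\<close>

locale entropy_fix =
  fixes N :: nat and v g h :: "nat \<Rightarrow> real" and \<beta> R :: real
  assumes weight_nonneg: "\<forall>i\<in>{1..N}. 0 \<le> v i"
    and g_nonneg: "\<And>i. i \<in> {1..N} \<Longrightarrow> 0 \<le> g i"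
    and g_le: "\<And>i. i \<in> {1..N} \<Longrightarrow> g i \<le> R"
    and h_nonneg: "\<And>i. i \<in> {1..N} \<Longrightarrow> 0 \<le> h i"
    and mass_g: "(\<Sum>i=1..N. g i * v i) = (\<Sum>i=1..N. v i)"
    and mass_h: "(\<Sum>i=1..N. h i * v i) = (\<Sum>i=1..N. v i)"
    and R_ge_1: "1 \<le> R"
    and beta_pos: "0 < \<beta>" and beta_le_1: "\<beta> \<le> 1"
    and entropy_eq: "entropy N v (\<lambda>i. g i + \<beta> * (1 - g i)) = entropy N v h"
begin

abbreviation "gap \<equiv> entropy N v g - entropy N v h"
abbreviation "err \<equiv> wnorm N v 2 (\<lambda>i. g i - h i)"

text \<open>Relaxation preserves mass, so the linear terms of \<open>x * ln x - x\<close> cancel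
  when the pointwise drops are summed. The freedom in \<open>s\<close> matters: at
  \<open>s = \<beta> = 1\<close> every logarithm vanishes and the bound is trivial.\<close>

lemma gap_ge:
  assumes "0 < s" "s \<le> \<beta>"
  shows "s * (\<Sum>i=1..N. (g i - 1) * ln (g i + s * (1 - g i)) * v i) \<le> gap"
proof -
  define z where "z i = g i + \<beta> * (1 - g i)" for i
  have "(\<Sum>i=1..N. z i * v i) = (1 - \<beta>) * (\<Sum>i=1..N. g i * v i) + \<beta> * (\<Sum>i=1..N. v i)"
    by (simp add: z_def sum_distrib_left sum.distrib[symmetric] algebra_simps)
  then have mass_z: "(\<Sum>i=1..N. z i * v i) = (\<Sum>i=1..N. v i)"
    using mass_g by (simp add: algebra_simps)
  have "s * (\<Sum>i=1..N. (g i - 1) * ln (g i + s * (1 - g i)) * v i)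
      = (\<Sum>i=1..N. s * ((g i - 1) * ln (g i + s * (1 - g i))) * v i)"
    by (simp add: sum_distrib_left mult.assoc)
  also have "\<dots> \<le> (\<Sum>i=1..N. ((g i * ln (g i) - g i) - (z i * ln (z i) - z i)) * v i)"
    unfolding z_def
    by (intro sum_mono mult_right_mono xlnx_relaxation_drop)
       (use assms g_nonneg weight_nonneg beta_le_1 in auto)
  also have "\<dots> = entropy N v g - entropy N v z"
    using mass_g mass_z by (simp add: entropy_def algebra_simps sum.distrib sum_subtractf)
  also have "entropy N v z = entropy N v h" unfolding entropy_eq[symmetric] z_def ..
  finally show ?thesis .
qed

lemma gap_eq:
  "gap = (\<Sum>i=1..N. ((g i * ln (g i) - g i) - (h i * ln (h i) - h i)) * v i)"
  using mass_g mass_h by (simp add: entropy_def algebra_simps sum.distrib sum_subtractf)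

lemma gap_le:
  assumes "0 < \<sigma>"
  shows "gap \<le> (\<Sum>i=1..N. \<bar>g i - h i\<bar> * \<bar>ln (max (g i) \<sigma>)\<bar> * v i) + \<sigma> * (\<Sum>i=1..N. v i)"
proof -
  have "gap = (\<Sum>i=1..N. ((g i * ln (g i) - g i) - (h i * ln (h i) - h i)) * v i)"
      by (rule gap_eq)
  also have "\<dots> \<le> (\<Sum>i=1..N. (\<bar>g i - h i\<bar> * \<bar>ln (max (g i) \<sigma>)\<bar> + \<sigma>) * v i)"
  proof (intro sum_mono mult_right_mono)
    fix i assume i: "i \<in> {1..N}"
    have "(g i - h i) * ln (max (g i) \<sigma>) \<le> \<bar>g i - h i\<bar> * \<bar>ln (max (g i) \<sigma>)\<bar>"
      by (metis abs_ge_self abs_mult)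
    then show "(g i * ln (g i) - g i) - (h i * ln (h i) - h i)
        \<le> \<bar>g i - h i\<bar> * \<bar>ln (max (g i) \<sigma>)\<bar> + \<sigma>"
      using xlnx_diff_le[OF g_nonneg[OF i] h_nonneg[OF i] assms] by linarith
  qed (use weight_nonneg in auto)
  finally show ?thesis by (simp add: distrib_right sum.distrib sum_distrib_left)
qed

text \<open>Later \<open>err\<close> itself is the cutoff in \<open>gap_le\<close>, which has to be
  positive. If it were 0, \<open>gap_le\<close> would bound \<open>gap\<close> by arbitrarily small
  numbers.\<close>

lemma err_pos:
  assumes "0 < gap"
  shows "0 < err"
proof (rule ccontr)
  assume "\<not> 0 < err"
  then have err: "err = 0" using wnorm_2_nonneg[of N v "\<lambda>i. g i - h i"] by linarith
  define W where "W = (\<Sum>i=1..N. v i)"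
  define \<sigma> where "\<sigma> = gap / (W + 1)"
  have W: "0 \<le> W" unfolding W_def using weight_nonneg by (intro sum_nonneg) simp
  then have \<sigma>: "0 < \<sigma>" using assms by (simp add: \<sigma>_def)
  have "(\<Sum>i=1..N. \<bar>g i - h i\<bar> * \<bar>ln (max (g i) \<sigma>)\<bar> * v i) \<le> 0"
    using wnorm_2_Cauchy_Schwarz[OF weight_nonneg, of "\<lambda>i. g i - h i" "\<lambda>i. ln (max (g i) \<sigma>)"]
    unfolding err by simp
  then have "gap \<le> \<sigma> * W" using gap_le[OF \<sigma>] unfolding W_def by linarith
  also have "\<sigma> * W < \<sigma> * (W + 1)" using \<sigma> by simp
  also have "\<dots> = gap" using W by (simp add: \<sigma>_def)
  finally show False by simp
qed

text \<open>This allows the sum in \<open>gap_ge\<close> to be restricted to a subset of the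
  indices.\<close>

lemma term_nonneg:
  assumes "i \<in> {1..N}" "0 < s" "s \<le> 1"
  shows "0 \<le> (g i - 1) * ln (g i + s * (1 - g i)) * v i"
proof -
  have "0 \<le> (1 - s) * (g i - 1)\<^sup>2 / R" using assms R_ge_1 by simp
  also have "\<dots> \<le> (g i - 1) * ln (g i + s * (1 - g i))"
    using assms g_nonneg g_le R_ge_1 by (intro relaxation_ln_ge) auto
  finally show ?thesis using assms weight_nonneg by simp
qed

section \<open>Bounds for the correction and for \<open>\<beta>\<close>\<close>

lemma correction_le: "wnorm N v 2 (\<lambda>i. 1 - g i) \<le> R * sqrt (\<Sum>i=1..N. v i)"
proof (rule wnorm_2_le)
  fix i assume "i \<in> {1..N}"
  then show "\<bar>1 - g i\<bar> \<le> R" using g_nonneg[of i] g_le[of i] R_ge_1 by linarith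
qed (use weight_nonneg R_ge_1 in auto)

text \<open>With \<open>d\<close> the norm of \<open>1 - g\<close>, the lower bound for
  \<open>gap\<close> is \<open>\<beta>\<close> times a quadratic in \<open>d\<close>, while the
  upper bound is linear in both \<open>d\<close> and \<open>err\<close>. Cancelling one
  \<open>d\<close> leaves the claim.\<close>

lemma correction_le_if_bounded_below:
  assumes m: "0 < m" "m \<le> 1" and lb: "\<And>i. i \<in> {1..N} \<Longrightarrow> m \<le> g i"
  shows "\<beta> * wnorm N v 2 (\<lambda>i. 1 - g i) \<le> 4 * R / m * err"
proof -
  define d where "d = wnorm N v 2 (\<lambda>i. 1 - g i)"
  have "0 \<le> d" "0 \<le> err" unfolding d_def by (rule wnorm_2_nonneg)+
  have d2: "d\<^sup>2 = (\<Sum>i=1..N. (1 - g i)\<^sup>2 * v i)"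
    unfolding d_def wnorm_2[OF weight_nonneg]
    using weight_nonneg by (intro real_sqrt_pow2 sum_nonneg) simp
  have lower: "\<beta> * d\<^sup>2 / (4 * R) \<le> gap"
  proof -
    \<comment> \<open>Taking \<open>s = \<beta> / 2\<close> keeps the factor \<open>1 - s\<close> at
      least 1/2.\<close>
    have "\<beta> * d\<^sup>2 / (4 * R) = \<beta> / 2 * (\<Sum>i=1..N. (1 / 2) * (g i - 1)\<^sup>2 / R * v i)"
      by (simp add: d2 sum_distrib_left sum_divide_distrib power2_commute[of 1] mult_ac)
    also have "\<dots> \<le> \<beta> / 2 * (\<Sum>i=1..N. (g i - 1) * ln (g i + \<beta> / 2 * (1 - g i)) * v i)"
    proof (intro mult_left_mono sum_mono mult_right_mono)
      fix i assume i: "i \<in> {1..N}"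
      have "(1 / 2) * (g i - 1)\<^sup>2 / R \<le> (1 - \<beta> / 2) * (g i - 1)\<^sup>2 / R"
        using beta_le_1 R_ge_1 by (intro divide_right_mono mult_right_mono) auto
      also have "\<dots> \<le> (g i - 1) * ln (g i + \<beta> / 2 * (1 - g i))"
        using i g_nonneg g_le R_ge_1 beta_pos beta_le_1 by (intro relaxation_ln_ge) auto
      finally show "(1 / 2) * (g i - 1)\<^sup>2 / R \<le> (g i - 1) * ln (g i + \<beta> / 2 * (1 - g i))" .
    qed (use weight_nonneg beta_pos in auto)
    also have "\<dots> \<le> gap" using beta_pos by (intro gap_ge) auto
    finally show ?thesis .
  qed
  have upper: "gap \<le> err * d / m"
  proof -
    have "gap \<le> (\<Sum>i=1..N. (\<bar>g i - h i\<bar> * \<bar>1 - g i\<bar> * v i) / m)"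
    proof -
      have "gap = (\<Sum>i=1..N. ((g i * ln (g i) - g i) - (h i * ln (h i) - h i)) * v i)"
      by (rule gap_eq)
      also have "\<dots> \<le> (\<Sum>i=1..N. (\<bar>g i - h i\<bar> * (\<bar>1 - g i\<bar> / m)) * v i)"
      proof (intro sum_mono mult_right_mono)
        fix i assume i: "i \<in> {1..N}"
        have gi: "0 < g i" using lb[OF i] m by simp
        \<comment> \<open>Both signs of \<open>ln (g i)\<close> are bounded by
          \<open>\<bar>1 - g i\<bar> / m\<close>: the negative one through
          \<open>m \<le> g i\<close>, the positive one through \<open>m \<le> 1\<close>.\<close>
        have "1 - g i \<le> \<bar>1 - g i\<bar>" by simp
        then have "(1 - g i) / g i \<le> \<bar>1 - g i\<bar> / m"
          using lb[OF i] m gi by (intro frac_le) auto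
        moreover have "- ln (g i) \<le> (1 - g i) / g i"
          using ln_ge_one_minus_inverse[OF gi] by (simp add: diff_divide_distrib)
        moreover have "ln (g i) \<le> \<bar>1 - g i\<bar>" using ln_le_minus_one[OF gi] by simp
        moreover have "\<bar>1 - g i\<bar> \<le> \<bar>1 - g i\<bar> / m"
          using m divide_left_mono[of m 1 "\<bar>1 - g i\<bar>"] by simp
        ultimately have "\<bar>ln (g i)\<bar> \<le> \<bar>1 - g i\<bar> / m" by linarith
        then have "\<bar>g i - h i\<bar> * \<bar>ln (g i)\<bar> \<le> \<bar>g i - h i\<bar> * (\<bar>1 - g i\<bar> / m)"
          by (intro mult_left_mono) auto
        moreover have "(g i - h i) * ln (g i) \<le> \<bar>g i - h i\<bar> * \<bar>ln (g i)\<bar>"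
          by (metis abs_ge_self abs_mult)
        ultimately show "(g i * ln (g i) - g i) - (h i * ln (h i) - h i)
            \<le> \<bar>g i - h i\<bar> * (\<bar>1 - g i\<bar> / m)"
          using xlnx_tangent[OF h_nonneg[OF i] gi] by (simp add: algebra_simps)
      qed (use weight_nonneg in auto)
      finally show ?thesis by (simp add: mult_ac)
    qed
    also have "\<dots> \<le> err * d / m"
      using wnorm_2_Cauchy_Schwarz[of N v "\<lambda>i. g i - h i" "\<lambda>i. 1 - g i"] weight_nonneg m
      by (simp add: sum_divide_distrib[symmetric] d_def divide_right_mono)
    finally show ?thesis .
  qed
  show ?thesis
  proof (cases "d = 0")
    case True
    then show ?thesis using \<open>0 \<le> err\<close> m R_ge_1 by (simp add: d_def)
  next
    case False
    have "\<beta> * d\<^sup>2 / (4 * R) \<le> err * d / m" using lower upper by linarith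
    then have "(\<beta> * d) * d \<le> (4 * R / m * err) * d"
      using R_ge_1 m by (simp add: field_simps power2_eq_square)
    then have "\<beta> * d \<le> 4 * R / m * err"
      by (rule mult_right_le_imp_le) (use False \<open>0 \<le> d\<close> in simp)
    then show ?thesis by (simp only: d_def)
  qed
qed

text \<open>Here \<open>m\<close> is any lower bound of \<open>g\<close>; the application takes
  \<open>g 1\<close>. If \<open>\<beta>\<close> exceeded \<open>K * err\<close>, then
  \<open>s = K * err\<close> would be admissible in \<open>gap_ge\<close>. On \<open>J\<close> the
  values of \<open>g\<close> relaxed by \<open>s\<close> are at most
  \<open>(1 + K) * \<mu> powr a\<close>, so \<open>gap / err\<close> is bounded below, and by
  \<open>gap_le\<close> above, by affine functions of \<open>- ln \<mu>\<close>. The lower one has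
  the larger slope, which is impossible for small \<open>\<mu>\<close>.\<close>

lemma beta_le_if_concentrated:
  assumes err: "0 < err" "err \<le> 1"
    and lb: "\<And>i. i \<in> {1..N} \<Longrightarrow> m \<le> g i"
    and mu: "\<mu> = max m err"
    and J: "J \<subseteq> {1..N}" "c * (\<Sum>i=1..N. v i) \<le> (\<Sum>i\<in>J. v i)" "\<And>i. i \<in> J \<Longrightarrow> g i \<le> \<mu> powr a"
    and c: "0 < c" and a: "0 < a" "a \<le> 1" and V: "0 < V" "V = (\<Sum>i=1..N. v i)"
    and K: "K = 4 / (c * a * sqrt V)"
    and small: "(2 * ln (1 + K) + ln 2) / a + R + sqrt V < - ln \<mu>"
  shows "\<beta> \<le> K * err"
proof (rule ccontr)
  assume "\<not> \<beta> \<le> K * err"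
  define s where "s = K * err"
  define L where "L = - ln \<mu>"
  have K0: "0 < K" using K c a V by simp
  have s: "0 < s" "s < \<beta>" using \<open>\<not> \<beta> \<le> K * err\<close> K0 err by (auto simp: s_def)
  have mu0: "0 < \<mu>" "err \<le> \<mu>" using mu err by auto
  have sV: "0 < sqrt V" using V by simp
  have lnK: "0 \<le> ln (1 + K)" using K0 by simp
  have "(2 * ln (1 + K) + ln 2) / a < L"
    using small R_ge_1 sV unfolding L_def by linarith
  then have aL: "2 * ln (1 + K) + ln 2 < a * L" using a by (simp add: field_simps)
  have aL0: "0 < a * L" and aLK: "0 \<le> a * L - ln (1 + K)"
    using aL lnK ln_gt_zero[of "2::real"] by linarith+
  have "L > 0" using aL0 a by (simp add: zero_less_mult_iff)
  then have mu1: "\<mu> < 1" using mu0 by (simp add: L_def)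
  have pw: "\<mu> powr a = exp (- (a * L))" using mu0 by (simp add: powr_def L_def)
  have "\<mu> powr 1 \<le> \<mu> powr a" using mu0 mu1 a by (intro powr_mono') auto
  then have mu_pw: "\<mu> \<le> \<mu> powr a" using mu0 by simp
  \<comment> \<open>The \<open>ln 2\<close> in \<open>small\<close> is there for this bound, which
    keeps \<open>1 - g i\<close> at least 1/2 on \<open>J\<close>.\<close>
  have half: "\<mu> powr a \<le> 1 / 2"
  proof -
    have "\<mu> powr a \<le> exp (- ln 2)" unfolding pw using aL lnK by simp
    then show ?thesis by (simp add: exp_minus)
  qed
  have lower: "K * err * (c * V * ((a * L - ln (1 + K)) / 2)) \<le> gap"
  proof -
    have "c * V * ((a * L - ln (1 + K)) / 2) \<le> (\<Sum>i\<in>J. v i) * ((a * L - ln (1 + K)) / 2)"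
      using J V aLK by (intro mult_right_mono) auto
    also have "\<dots> = (\<Sum>i\<in>J. (a * L - ln (1 + K)) / 2 * v i)"
      by (subst mult.commute) (rule sum_distrib_left)
    also have "\<dots> \<le> (\<Sum>i\<in>J. (g i - 1) * ln (g i + s * (1 - g i)) * v i)"
    proof (intro sum_mono mult_right_mono)
      fix i assume iJ: "i \<in> J"
      then have i: "i \<in> {1..N}" using J by auto
      define y where "y = g i + s * (1 - g i)"
      have "y = (1 - s) * g i + s" by (simp add: y_def algebra_simps)
      then have "0 < y" using s beta_le_1 g_nonneg[OF i] by (simp add: add_nonneg_pos)
      have "y \<le> g i + s" using s g_nonneg[OF i] by (simp add: y_def mult_left_le)
      also have "\<dots> \<le> \<mu> powr a + K * \<mu> powr a"
        using J(3)[OF iJ] mu0 mu_pw K0 unfolding s_def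
        by (intro add_mono mult_left_mono) auto
      finally have "y \<le> (1 + K) * \<mu> powr a" by (simp add: distrib_right)
      then have "ln y \<le> ln ((1 + K) * \<mu> powr a)" using \<open>0 < y\<close> by (intro ln_mono) auto
      also have "\<dots> = ln (1 + K) - a * L" using mu0 K0 by (simp add: ln_mult pw)
      finally have ln: "a * L - ln (1 + K) \<le> - ln y" by simp
      have "1 / 2 \<le> 1 - g i" using J(3)[OF iJ] half by simp
      then have "(1 / 2) * (a * L - ln (1 + K)) \<le> (1 - g i) * (- ln y)"
        using ln aLK by (intro mult_mono) auto
      then show "(a * L - ln (1 + K)) / 2 \<le> (g i - 1) * ln (g i + s * (1 - g i))"
        unfolding y_def[symmetric] by (simp add: left_diff_distrib)
    qed (use J weight_nonneg in auto)
    also have "\<dots> \<le> (\<Sum>i=1..N. (g i - 1) * ln (g i + s * (1 - g i)) * v i)"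
      using J s beta_le_1 by (intro sum_mono2 term_nonneg) auto
    finally have "s * (c * V * ((a * L - ln (1 + K)) / 2)) 
        \<le> s * (\<Sum>i=1..N. (g i - 1) * ln (g i + s * (1 - g i)) * v i)"
      using s by (intro mult_left_mono) auto
    also have "\<dots> \<le> gap" using s by (intro gap_ge) auto
    finally show ?thesis by (simp add: s_def)
  qed
  \<comment> \<open>With cutoff \<open>err\<close> the arguments of \<open>ln\<close> lie between
    \<open>\<mu>\<close> and \<open>R\<close>, and the extra term \<open>err * V\<close> is of the
    same order in \<open>err\<close>.\<close>
  have upper: "gap \<le> err * (sqrt V * (L + R) + V)"
  proof -
    have "(\<Sum>i=1..N. \<bar>g i - h i\<bar> * \<bar>ln (max (g i) err)\<bar> * v i)
        \<le> err * wnorm N v 2 (\<lambda>i. ln (max (g i) err))"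
      using weight_nonneg by (rule wnorm_2_Cauchy_Schwarz)
    also have "\<dots> \<le> err * ((L + R) * sqrt V)" unfolding V(2)
    proof (intro mult_left_mono wnorm_2_le)
      fix i assume i: "i \<in> {1..N}"
      let ?G = "max (g i) err"
      have G: "0 < ?G" "\<mu> \<le> ?G" "?G \<le> R" using lb[OF i] g_le[OF i] mu err R_ge_1 by auto
      have "- L \<le> ln ?G" using G mu0 by (simp add: L_def)
      moreover have "ln ?G \<le> R" using ln_le_minus_one[OF G(1)] G(3) by linarith
      ultimately show "\<bar>ln ?G\<bar> \<le> L + R" using \<open>L > 0\<close> R_ge_1 by linarith
    qed (use weight_nonneg \<open>L > 0\<close> R_ge_1 err in auto)
    finally show ?thesis using gap_le[OF err(1)] V by (simp add: algebra_simps)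
  qed
  have "err * (K * (c * V * ((a * L - ln (1 + K)) / 2))) \<le> err * (sqrt V * (L + R) + V)"
    using lower upper by (simp add: mult_ac)
  then have "K * (c * V * ((a * L - ln (1 + K)) / 2)) \<le> sqrt V * (L + R) + V"
    using err by simp
  \<comment> \<open>Origin of \<open>K\<close>: it makes the coefficient of \<open>L\<close> equal
    to \<open>2 * sqrt V\<close>, twice that in the upper bound, so \<open>L\<close> would stay
    below a value that \<open>small\<close> exceeds.\<close>
  also have "K * (c * V * ((a * L - ln (1 + K)) / 2)) = sqrt V * (2 * (L - ln (1 + K) / a))"
  proof -
    have "K * c * a * V = 4 * sqrt V"
      using c a V by (simp add: K field_simps)
    moreover have "K * (c * V * ((a * L - ln (1 + K)) / 2))
        = K * c * a * V * ((L - ln (1 + K) / a) / 2)" using a by (simp add: field_simps)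
    ultimately show ?thesis by (simp)
  qed
  also have "sqrt V * (L + R) + V = sqrt V * (L + R + sqrt V)"
    using V by (simp add: algebra_simps)
  finally have "2 * (L - ln (1 + K) / a) \<le> L + R + sqrt V" using sV by simp
  then have "L \<le> 2 * ln (1 + K) / a + R + sqrt V" by simp
  moreover have "2 * ln (1 + K) / a \<le> (2 * ln (1 + K) + ln 2) / a"
    using a by (intro divide_right_mono) auto
  ultimately show False using small by (simp add: L_def)
qed

end

section \<open>Condition (iii) as a power bound, and the mass index\<close>

lemma le_powr_if_inv_abs_log_le:
  assumes le: "ennreal C * inv_abs_log y \<le> inv_abs_log x"
    and C: "0 < C" and x: "0 \<le> x" "x < exp (- (R / C))" and y: "0 \<le> y" "y \<le> R" and "1 \<le> R"
  shows "y \<le> x powr C"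
proof (cases "y = 0")
  case False
  then have "0 < y" using y by simp
  have "exp (- (R / C)) < 1" using C \<open>1 \<le> R\<close> by simp
  then have "x < 1" using x by linarith
  \<comment> \<open>The conventions at 0 and 1 act here: with \<open>y\<close> positive,
    \<open>x = 0\<close> would make only the right side of \<open>le\<close> vanish, and
    \<open>y = 1\<close> would make only the left side infinite.\<close>
  have inv_y: "inv_abs_log y \<noteq> 0"
    using \<open>0 < y\<close> by (auto simp: inv_abs_log_def ennreal_eq_0_iff)
  then have "x \<noteq> 0" using le C by (auto simp: inv_abs_log_def[of x] ennreal_eq_0_iff)
  then have "0 < x" using x by simp
  have "y \<noteq> 1"
  proof
    assume "y = 1"
    then have "ennreal C * inv_abs_log y = \<infinity>"
      using C by (simp add: inv_abs_log_def ennreal_mult_eq_top_iff ennreal_eq_0_iff)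
    then show False
      using le \<open>x < 1\<close> \<open>x \<noteq> 0\<close> by (simp add: inv_abs_log_def[of x] top_unique)
  qed
  then have "ennreal (C * (1 / \<bar>ln y\<bar>)) \<le> ennreal (1 / \<bar>ln x\<bar>)"
    using le \<open>0 < x\<close> \<open>x < 1\<close> \<open>0 < y\<close> C by (simp add: inv_abs_log_def ennreal_mult[symmetric])
  then have "C * (1 / \<bar>ln y\<bar>) \<le> 1 / \<bar>ln x\<bar>" by (subst (asm) ennreal_le_iff) auto
  moreover have "0 < \<bar>ln y\<bar>" "0 < - ln x"
    using \<open>y \<noteq> 1\<close> \<open>0 < y\<close> \<open>0 < x\<close> \<open>x < 1\<close> by auto
  ultimately have ln: "C * (- ln x) \<le> \<bar>ln y\<bar>" by (simp add: field_simps)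
  \<comment> \<open>A positive \<open>ln y\<close> would have to exceed \<open>R\<close>, which
    contradicts \<open>ln y \<le> y - 1\<close>; so \<open>ln y\<close> is negative and the absolute
    value resolves.\<close>
  have "ln x < - (R / C)" using x \<open>0 < x\<close> by (metis exp_gt_zero ln_exp ln_less_cancel_iff)
  then have "R < C * (- ln x)" using C by (simp add: field_simps)
  moreover have "ln y \<le> R" using ln_le_minus_one[OF \<open>0 < y\<close>] y by simp
  ultimately have "ln y \<le> C * ln x" using ln by linarith
  then have "exp (ln y) \<le> exp (C * ln x)" by simp
  then show ?thesis using \<open>0 < x\<close> \<open>0 < y\<close> by (simp add: powr_def)
qed (use powr_ge_zero in simp)

lemma mass_index:
  assumes "1 \<le> N" "m \<le> (\<Sum>i=1..N. v i)"
  shows "mass_index N v m \<in> {1..N}" "m \<le> (\<Sum>i=1..mass_index N v m. v i)"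
proof -
  have "N \<in> {1..N} \<and> m \<le> (\<Sum>i=1..N. v i)" using assms by simp
  from LeastI[of "\<lambda>I. I \<in> {1..N} \<and> m \<le> (\<Sum>i=1..I. v i)", OF this]
  show "mass_index N v m \<in> {1..N}" "m \<le> (\<Sum>i=1..mass_index N v m. v i)"
    unfolding mass_index_def by auto
qed

section \<open>Uniform constants and case distinction\<close>

theorem theorem2p5:
  fixes C\<^sub>1 C\<^sub>f V :: real
  assumes "0 < C\<^sub>1" "C\<^sub>1 \<le> 1" "0 < C\<^sub>f" "C\<^sub>f \<le> 1" "0 < V"
  shows "\<exists>(\<delta>::real) (M :: real \<Rightarrow> real \<Rightarrow> real).
    \<delta> > 0 \<and> (\<forall>x y. M x y > 0) \<and>
    (\<forall>(N::nat) (v :: nat \<Rightarrow> real) (Q :: (nat \<Rightarrow> real) \<Rightarrow> nat \<Rightarrow> real)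
        (t0::real) (t1::real) (f :: real \<Rightarrow> nat \<Rightarrow> real) (fn :: nat \<Rightarrow> real)
        (fnew :: nat \<Rightarrow> real) (\<beta>::real).
       N \<ge> 1 \<longrightarrow> (\<forall>i\<in>{1..N}. v i > 0) \<longrightarrow> V = (\<Sum>i=1..N. v i) \<longrightarrow>
       entropic_system N v Q \<longrightarrow>
       fn \<in> nonneg_vecs N \<longrightarrow> wnorm N v 1 fn = V \<longrightarrow>
       t0 < t1 \<longrightarrow> ode_solution N Q t0 t1 f \<longrightarrow> f t0 = fn \<longrightarrow>
       fnew \<in> nonneg_vecs N \<longrightarrow>
       wnorm N v 1 fnew = wnorm N v 1 (f t1) \<longrightarrow> wnorm N v 1 (f t1) = V \<longrightarrow>
       mono_on {1..N} fnew \<longrightarrow>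
       entropy N v fnew > entropy N v fn \<longrightarrow>
       0 < \<beta> \<longrightarrow> \<beta> \<le> 1 \<longrightarrow>
       entropy N v (\<lambda>i. fnew i + \<beta> * (1 - fnew i)) = entropy N v (f t1) \<longrightarrow>
       wnorm N v 2 (\<lambda>i. fnew i - f t1 i) < \<delta> \<longrightarrow>
       inv_abs_log (fnew 1) \<ge> ennreal C\<^sub>f * inv_abs_log (fnew (mass_index N v (C\<^sub>1 * V))) \<longrightarrow>
       wnorm N v 2 (\<lambda>i. \<beta> * (1 - fnew i))
         \<le> M (maxnorm N fnew) (maxnorm N (f t1)) * wnorm N v 2 (\<lambda>i. fnew i - f t1 i))"
proof -
  define K where "K = 4 / (C\<^sub>1 * C\<^sub>f * sqrt V)"
  \<comment> \<open>\<open>L R\<close> meets two demands: the hypothesis \<open>small\<close> of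
    \<open>beta_le_if_concentrated\<close>, and, by its summand \<open>R / C\<^sub>f\<close>, the
    smallness of \<open>g 1\<close> in \<open>le_powr_if_inv_abs_log_le\<close>.\<close>
  define L where "L R = (2 * ln (1 + K) + ln 2) / C\<^sub>f + R / C\<^sub>f + sqrt V" for R
  define m where "m R = exp (- L R)" for R
  \<comment> \<open>One summand for each of the three cases below.\<close>
  define B where "B R = R * sqrt V / m R + 4 * R / m R + K * (R * sqrt V)" for R
  have sV: "0 < sqrt V" using assms by simp
  have K0: "0 < K" using assms by (simp add: K_def)
  have m0: "0 < m R" for R by (simp add: m_def)
  have L_gt: "R / C\<^sub>f < L R" for R
  proof -
    have "0 < (2 * ln (1 + K) + ln 2) / C\<^sub>f"
      using K0 assms by (intro divide_pos_pos add_nonneg_pos) auto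
    then show ?thesis using sV unfolding L_def by linarith
  qed
  have m1: "m R \<le> 1" if "1 \<le> R" for R
  proof -
    have "0 \<le> R / C\<^sub>f" using that assms by simp
    then show ?thesis using L_gt[of R] by (simp add: m_def)
  qed
  have parts: "0 < R * sqrt V / m R" "0 < 4 * R / m R" "0 < K * (R * sqrt V)" if "1 \<le> R" for R
    using that sV K0 m0[of R] by auto
  have B0: "0 < B R" if "1 \<le> R" for R using parts[OF that] by (simp add: B_def)
  have main: "wnorm N v 2 (\<lambda>i. \<beta> * (1 - g i))
      \<le> B (max 1 (maxnorm N g)) * wnorm N v 2 (\<lambda>i. g i - f t1 i)"
    if N: "N \<ge> 1" and v: "\<forall>i\<in>{1..N}. v i > 0" and V: "V = (\<Sum>i=1..N. v i)"
      and Q: "entropic_system N v Q" and fn: "fn \<in> nonneg_vecs N"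
      and t: "t0 < t1" and f: "ode_solution N Q t0 t1 f" "f t0 = fn"
      and g: "g \<in> nonneg_vecs N" and mass: "wnorm N v 1 g = V" "wnorm N v 1 (f t1) = V"
      and mono: "mono_on {1..N} g" and ent: "entropy N v g > entropy N v fn"
      and \<beta>: "0 < \<beta>" "\<beta> \<le> 1"
      and eq: "entropy N v (\<lambda>i. g i + \<beta> * (1 - g i)) = entropy N v (f t1)"
      and iii: "inv_abs_log (g 1) \<ge> ennreal C\<^sub>f * inv_abs_log (g (mass_index N v (C\<^sub>1 * V)))"
    for N v Q t0 t1 f fn g \<beta>
  proof -
    define R where "R = max 1 (maxnorm N g)"
    have R1: "1 \<le> R" by (simp add: R_def)
    define h where "h = f t1"
    have v0: "\<forall>i\<in>{1..N}. 0 \<le> v i" using v by (auto intro: less_imp_le)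
    have sys: "(\<forall>t\<in>{t0..t1}. \<forall>i\<in>{1..N}. 0 \<le> f t i) \<and>
        antimono_on {t0..t1} (\<lambda>t. entropy N v (f t))"
      using Q[unfolded entropic_system_def, rule_format, OF t f(1)] f(2) fn by blast
    then have h0: "\<And>i. i \<in> {1..N} \<Longrightarrow> 0 \<le> h i" using t by (simp add: h_def)
    \<comment> \<open>Entropy decay along the flow and condition (i) make the gap positive, hence
      also \<open>err\<close>.\<close>
    have "entropy N v h \<le> entropy N v fn"
      using sys t f(2) unfolding h_def monotone_on_def by fastforce
    then have gap: "entropy N v h < entropy N v g" using ent by simp
    have g0: "\<And>i. i \<in> {1..N} \<Longrightarrow> 0 \<le> g i" using g unfolding nonneg_vecs_def by (auto dest: PiE_mem)
    have gR: "g i \<le> R" if "i \<in> {1..N}" for i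
    proof -
      have "\<bar>g i\<bar> \<le> maxnorm N g" unfolding maxnorm_def using that by (intro Max_ge) auto
      then show ?thesis by (simp add: R_def)
    qed
    interpret entropy_fix N v g h \<beta> R
    proof
      have "(\<Sum>i=1..N. g i * v i) = (\<Sum>i=1..N. \<bar>g i\<bar> * v i)" using g0 by (intro sum.cong) auto
      then show "(\<Sum>i=1..N. g i * v i) = (\<Sum>i=1..N. v i)" using mass(1) V wnorm_1[OF v0] by simp
      have "(\<Sum>i=1..N. h i * v i) = (\<Sum>i=1..N. \<bar>h i\<bar> * v i)" using h0 by (intro sum.cong) auto
      then show "(\<Sum>i=1..N. h i * v i) = (\<Sum>i=1..N. v i)"
        using mass(2) V wnorm_1[OF v0] by (simp add: h_def)
      show "entropy N v (\<lambda>i. g i + \<beta> * (1 - g i)) = entropy N v h" using eq by (simp add: h_def)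
    qed (fact v0 g0 gR h0 R1 \<beta>)+
    define d where "d = wnorm N v 2 (\<lambda>i. 1 - g i)"
    have d: "0 \<le> d" "d \<le> R * sqrt V"
      using wnorm_2_nonneg correction_le V by (auto simp: d_def)
    have err0: "0 \<le> err" by (rule wnorm_2_nonneg)
    have lb: "\<And>i. i \<in> {1..N} \<Longrightarrow> g 1 \<le> g i" using mono N by (auto simp: monotone_on_def)
    have B_ge: "R * sqrt V / m R * err \<le> B R * err" "4 * R / m R * err \<le> B R * err"
      "K * (R * sqrt V) * err \<le> B R * err"
      using parts[OF R1] err0 by (auto intro!: mult_right_mono simp only: B_def)
    have "\<beta> * d \<le> B R * err"
    proof -
      consider "m R \<le> err" | "m R \<le> g 1" | "err < m R" "g 1 < m R" by linarith
      then show ?thesis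
      proof cases
        case 1
        have "\<beta> * d \<le> 1 * (R * sqrt V)" using \<beta> d by (intro mult_mono) auto
        also have "\<dots> \<le> R * sqrt V / m R * err"
          using mult_left_mono[OF 1, of "R * sqrt V"] m0[of R] R1 sV by (simp add: field_simps)
        finally show ?thesis using B_ge by linarith
      next
        case 2
        then have "\<beta> * d \<le> 4 * R / m R * err"
          unfolding d_def using m0 m1[OF R1] lb
          by (intro correction_le_if_bounded_below) (auto intro: order_trans)
        then show ?thesis using B_ge by linarith
      next
        case 3
        define \<mu> where "\<mu> = max (g 1) err"
        define I where "I = mass_index N v (C\<^sub>1 * V)"
        have "C\<^sub>1 * V \<le> (\<Sum>i=1..N. v i)" using assms V by (metis mult_left_le_one_le less_imp_le)
        from mass_index[OF N this] have I: "I \<in> {1..N}" "C\<^sub>1 * V \<le> (\<Sum>i=1..I. v i)"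
          by (auto simp: I_def)
        have err_pos: "0 < err" using gap by (intro err_pos) simp
        have "g I \<le> g 1 powr C\<^sub>f"
        proof (rule le_powr_if_inv_abs_log_le)
          show "ennreal C\<^sub>f * inv_abs_log (g I) \<le> inv_abs_log (g 1)" using iii by (simp add: I_def)
          have "m R < exp (- (R / C\<^sub>f))" using L_gt[of R] by (simp add: m_def)
          then show "g 1 < exp (- (R / C\<^sub>f))" using 3 by linarith
        qed (use assms g0 gR R1 I N in auto)
        \<comment> \<open>\<open>g 1\<close> may vanish, whereas \<open>\<mu>\<close> is positive
          because \<open>err\<close> is, so its logarithm is meaningful.\<close>
        also have "\<dots> \<le> \<mu> powr C\<^sub>f"
          using assms g0 N by (intro powr_mono2) (auto simp: \<mu>_def)
        finally have gI: "g I \<le> \<mu> powr C\<^sub>f" .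
        have "0 < \<mu>" "\<mu> < m R" using err_pos 3 by (auto simp: \<mu>_def)
        then have "ln \<mu> < - L R" unfolding m_def by (metis exp_gt_zero ln_exp ln_less_cancel_iff)
        moreover have "R \<le> R / C\<^sub>f" using assms R1 by (simp add: field_simps)
        ultimately have small: "(2 * ln (1 + K) + ln 2) / C\<^sub>f + R + sqrt V < - ln \<mu>"
          by (simp add: L_def)
        have "\<beta> \<le> K * err"
        \<comment> \<open>By the ordering, the components up to \<open>I\<close> are at most
          \<open>g I\<close>, and their weight is at least \<open>C\<^sub>1 * V\<close>.\<close>
        proof (rule beta_le_if_concentrated[where J = "{1..I}"])
          show "\<And>i. i \<in> {1..I} \<Longrightarrow> g i \<le> \<mu> powr C\<^sub>f"
            using gI mono I by (fastforce simp: monotone_on_def)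
          show "err \<le> 1" using 3 m1[OF R1] by linarith
          show "{1..I} \<subseteq> {1..N}" using I by simp
          show "C\<^sub>1 * (\<Sum>i=1..N. v i) \<le> (\<Sum>i=1..I. v i)" using I V by simp
        qed (fact err_pos lb \<mu>_def V assms K_def small)+
        then have "\<beta> * d \<le> (K * err) * (R * sqrt V)" using d err0 K0 by (intro mult_mono) auto
        then show ?thesis using B_ge by (simp add: mult_ac)
      qed
    qed
    then show ?thesis
      using wnorm_2_cmult[OF v0, of \<beta> "\<lambda>i. 1 - g i"] \<beta> by (simp add: d_def R_def h_def)
  qed
  show ?thesis
  \<comment> \<open>\<open>B\<close> absorbs large errors, so \<open>\<delta> = 1\<close> serves.
    The \<open>max 1 x\<close> makes \<open>M\<close> positive at every real argument, since
    \<open>B\<close> is known to be positive from 1 on.\<close>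
  proof (intro exI[of _ "1::real"] exI[of _ "\<lambda>x y. B (max 1 x)"] conjI allI impI, goal_cases)
    case (3 N v Q t0 t1 f fn fnew \<beta>)
    moreover have "wnorm N v 1 fnew = V" using 3(11,12) by (rule trans)
    ultimately show ?case by (intro main) assumption+
  qed (use B0 in auto)
qed

end
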